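(* Let $\mathcal{G}$ be the two-player augmented security game between the utility company $\mathcal{U}$ and the attacker $\mathcal{A}$ described in the context, with real parameters satisfying the standing assumptions listed there. If $$l^{\mathcal{U}}_{att\circ} - c^{\mathcal{A}}_{att\circ} < l^{\mathcal{U}}_{att} - c^{\mathcal{A}}_{att},$$ then $\mathcal{G}$ admits no pure Nash Equilibrium.
   Context: The game $\mathcal{G}$ is a two-player nonzero-sum complete-information game in normal form. Player $\mathcal{U}$ (utility company) has the pure strategies $S_{\mathcal{U}} = \{s^{\mathcal{U}}_{mon}, s^{\mathcal{U}}_{-mon}\}$ (monitor, do not monitor). Player $\mathcal{A}$ (attacker) has the pure strategies $S_{\mathcal{A}} = \{s^{\mathcal{A}}_{att\circ}, s^{\mathcal{A}}_{att}, s^{\mathcal{A}}_{-att}\}$ (weak attack, strong attack, no attack). Parameters (real numbers): $c^{\mathcal{U}}_{mon}$ (monitoring cost), $c^{\mathcal{U}}_{def}$ (defence cost), $l^{\mathcal{U}}_{att\circ}$ and $l^{\mathcal{U}}_{att}$ (losses of $\mathcal{U}$ from a weak and a strong attack, which are equal to the attacker's benefits), $c^{\mathcal{A}}_{att\circ}$ and $c^{\mathcal{A}}_{att}$ (attacker's costs of a weak and a strong attack). Payoffs (payoff of $\mathcal{U}$, payoff of $\mathcal{A}$): - $(s^{\mathcal{U}}_{mon}, s^{\mathcal{A}}_{att\circ})$: $(-c^{\mathcal{U}}_{mon} - l^{\mathcal{U}}_{att\circ},\ l^{\mathcal{U}}_{att\circ} - c^{\mathcal{A}}_{att\circ})$ -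 $(s^{\mathcal{U}}_{mon}, s^{\mathcal{A}}_{att})$: $(-c^{\mathcal{U}}_{mon} - c^{\mathcal{U}}_{def},\ -c^{\mathcal{A}}_{att})$ - $(s^{\mathcal{U}}_{mon}, s^{\mathcal{A}}_{-att})$: $(-c^{\mathcal{U}}_{mon},\ 0)$ - $(s^{\mathcal{U}}_{-mon}, s^{\mathcal{A}}_{att\circ})$: $(-l^{\mathcal{U}}_{att\circ},\ l^{\mathcal{U}}_{att\circ} - c^{\mathcal{A}}_{att\circ})$ - $(s^{\mathcal{U}}_{-mon}, s^{\mathcal{A}}_{att})$: $(-l^{\mathcal{U}}_{att},\ l^{\mathcal{U}}_{att} - c^{\mathcal{A}}_{att})$ - $(s^{\mathcal{U}}_{-mon}, s^{\mathcal{A}}_{-att})$: $(0,\ 0)$ Standing assumptions: $l^{\mathcal{U}}_{att} > 0$; $c^{\mathcal{U}}_{mon} > 0$; $c^{\mathcal{A}}_{att} > 0$; $c^{\mathcal{U}}_{mon} + c^{\mathcal{U}}_{def} < l^{\mathcal{U}}_{att}$; $l^{\mathcal{U}}_{att} - c^{\mathcal{A}}_{att} > 0$; $c^{\mathcal{A}}_{att\circ} < l^{\mathcal{U}}_{att\circ}$; $c^{\mathcal{A}}_{att} > c^{\mathcal{A}}_{att\circ}$; $l^{\mathcal{U}}_{att} > l^{\mathcal{U}}_{att\circ}$. A pure strategy profile is a pure Nash Equilibrium if neither player can strictly increase their own payoff by a unilateral change of strategy. *)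

theory Defs
  imports Complex_Main
begin

text \<open>
  Two-player normal-form games; the pure strategy sets of the two players are the types
  \<open>'s\<close> and \<open>'t\<close>.
\<close>

record ('s, 't) two_player_game =
  payoff1 :: "'s \<Rightarrow> 't \<Rightarrow> real"
  payoff2 :: "'s \<Rightarrow> 't \<Rightarrow> real"

definition pure_nash :: "('s, 't) two_player_game \<Rightarrow> 's \<times> 't \<Rightarrow> bool" where
  "pure_nash G = (\<lambda>(s, t).
     \<not> (\<exists>s'. payoff1 G s' t > payoff1 G s t) \<and>
     \<not> (\<exists>t'. payoff2 G s t' > payoff2 G s t))"

datatype utility_strategy = Monitor | No_Monitor

datatype attacker_strategy = Weak_Attack | Strong_Attack | No_Attack

text \<open>
  In the field names, the suffixes \<open>_U\<close> and \<open>_A\<close> name the player concerned. The losses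
  \<open>l_weak_U\<close> and \<open>l_att_U\<close> of the utility company are also the attacker's benefits.
\<close>

record security_params =
  c_mon_U :: real
  c_def_U :: real
  l_weak_U :: real
  l_att_U :: real
  c_weak_A :: real
  c_att_A :: real

fun utility_payoff :: "security_params \<Rightarrow> utility_strategy \<Rightarrow> attacker_strategy \<Rightarrow> real" where
  "utility_payoff p Monitor Weak_Attack = - c_mon_U p - l_weak_U p"
| "utility_payoff p Monitor Strong_Attack = - c_mon_U p - c_def_U p"
| "utility_payoff p Monitor No_Attack = - c_mon_U p"
| "utility_payoff p No_Monitor Weak_Attack = - l_weak_U p"
| "utility_payoff p No_Monitor Strong_Attack = - l_att_U p"
| "utility_payoff p No_Monitor No_Attack = 0"

fun attacker_payoff :: "security_params \<Rightarrow> utility_strategy \<Rightarrow> attacker_strategy \<Rightarrow> real" where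
  "attacker_payoff p Monitor Weak_Attack = l_weak_U p - c_weak_A p"
| "attacker_payoff p Monitor Strong_Attack = - c_att_A p"
| "attacker_payoff p Monitor No_Attack = 0"
| "attacker_payoff p No_Monitor Weak_Attack = l_weak_U p - c_weak_A p"
| "attacker_payoff p No_Monitor Strong_Attack = l_att_U p - c_att_A p"
| "attacker_payoff p No_Monitor No_Attack = 0"

definition security_game ::
    "security_params \<Rightarrow> (utility_strategy, attacker_strategy) two_player_game" where
  "security_game p = \<lparr> payoff1 = utility_payoff p, payoff2 = attacker_payoff p \<rparr>"

end

theory Submission
  imports Defs
begin

text \<open>
  The attacker's unique best reply to monitoring is the weak attack, against which monitoring
  is a wasted cost; the unique best reply to not monitoring is the strong attack, against
  which monitoring pays off.
\<close>

theorem mainTheorem2: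
  fixes p :: security_params
  assumes "l_att_U p > 0"
    and "c_mon_U p > 0"
    and "c_att_A p > 0"
    and "c_mon_U p + c_def_U p < l_att_U p"
    and "l_att_U p - c_att_A p > 0"
    and "c_weak_A p < l_weak_U p"
    and "c_att_A p > c_weak_A p"
    and "l_att_U p > l_weak_U p"
    and "l_weak_U p - c_weak_A p < l_att_U p - c_att_A p"
  shows "\<not> (\<exists>profile. pure_nash (security_game p) profile)"
proof
  assume "\<exists>profile. pure_nash (security_game p) profile"
  then obtain s t where "pure_nash (security_game p) (s, t)"
    by auto
  then have U: "utility_payoff p s' t \<le> utility_payoff p s t"
    and A: "attacker_payoff p s t' \<le> attacker_payoff p s t" for s' t'
    by (auto simp: pure_nash_def security_game_def not_less)
  show False
  proof (cases s)
    case Monitor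
    \<comment> \<open>Under monitoring, a weak attack earns
      \<open>l_weak_U p - c_weak_A p > 0\<close>, while the alternatives earn
      \<open>- c_att_A p < 0\<close> and 0.\<close>
    with A[of Weak_Attack] assms have "t = Weak_Attack"
      by (cases t) auto
    with U[of No_Monitor] Monitor assms show False
      by simp
  next
    case No_Monitor
    \<comment> \<open>The last assumption enters here: it rules out the weak attack, and
      \<open>l_att_U p - c_att_A p > 0\<close> rules out not attacking.\<close>
    with A[of Strong_Attack] assms have "t = Strong_Attack"
      by (cases t) auto
    \<comment> \<open>Switching to monitoring replaces the loss \<open>l_att_U p\<close> by the
      smaller \<open>c_mon_U p + c_def_U p\<close>.\<close>
    with U[of Monitor] No_Monitor assms show False
      by simp
  qed
qed

end
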